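(* Let $V'$ be a $P_2$-algorithm, let the $i$-th step of $V'$ be a main step in which exactly two subsets are checked (for a fixed distribution $d'$ of checked subsets into steps), in places labelled $1$ and $2$, and let $S',R,T'$ be three input-sets from the input-class $V'_{input}(n,d')$ such that: $S'$ results in a subset-solution being determined as checked subset in place $1$ but none in place $2$ of the $i$-th step (outcome $1$); $R$ results in a subset-solution being determined as checked subset in place $2$ but none in place $1$ of the $i$-th step (outcome $2$); $T'$ results in no subset-solution being determined as checked subset in the $i$-th step (outcome $0$). Consider a family $F$ of boxes that assigns to each $q\in\mathbb{Q}\cap[0,1)$ a box $B'_{a,0/b}$ with $a,b\in\mathbb{N}$, $b\ne0$, $\frac{a}{b}=q$, and to $q=1$ a box $B'_{0,b/b}$ with $b\in\mathbb{N}$, $b\neq 0$. For $q\in\mathbb{Q}\cap[0,1]$ let $X'_q\in\{0,1,2\}$ be the outcome of an input-set selected uniformly at random from the box that $F$ assigns to $q$, and let $\pi_1(q)=\mathrm{prob}\{X'_q=1\}$. Then $$\pi_1(q)=\begin{cases} q & \text{if } q\in\mathbb{Q}\cap[0,1),\\ 0 & \text{if } q=1,\end{cases}$$ and the function $\pi_1:\mathbb{Q}\cap[0,1]\to[0,1]$ is discontinuous at the point $1$.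
   Context: Subset-sum problem: given a set of $n$ integers (an input-set), decide whether some non-empty subset sums to zero; such a subset is called a subset-solution. Only algorithms that determine, for every non-empty subset of the input-set, whether it is a subset-solution are considered. An algorithm checks a subset in a step if in that step it performs the final necessary operation to determine that subset independently of the other subsets; a step in which checking takes place is a main step. A $P_2$-algorithm is one for which there is at least one main step in which more than one subset is checked. The number of steps is taken to be the worst-case number for input-sets of size $n$ (empty steps are added if fewer are needed). A distribution is the tuple $d'=(d'_1,\dots,d'_k)$, where $k$ is the number of steps and $d'_j$ is the number of subsets checked in step $j$. An input-class $V'_{input}(n,d')$ is a class containing infinitely many input-sets of size $n$ that result in the same distribution $d'$ for $V'$. For the random experiment, each of $S',R,T'$ has a fixed outcome: $1$ for $S'$, $2$ for $R$, $0$ for $T'$. For $a_1,a_2,b\in\mathbb{N}$ with $b\neq0$ and $a=a_1+a_2\le b$, the box $B'_{a_1,a_2/b}$ is the multiset of cardinality $b$ with $a_1$ instances of $S'$, $a_2$ instances of $R$ and $b-a$ instances of $T'$; all $b$ instances are equally likely to be selected. In general, a box used for the value $q$ must satisfy $\frac{a_1+a_2}{b}=q$. $\mathbb{N}$ includes $0$. $\mathbb{Q}\cap[0,1]$ and $[0,1]$ carry the topology induced from $\mathbb{R}$. *)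

theory Defs
  imports "HOL-Probability.Probability"
begin

definition input_sets :: "nat \<Rightarrow> int set set" where
  "input_sets n = {I. finite I \<and> card I = n}"

definition nonempty_subsets :: "int set \<Rightarrow> int set set" where
  "nonempty_subsets I = {X. X \<subseteq> I \<and> X \<noteq> {}}"

definition subset_solution :: "int set \<Rightarrow> int set \<Rightarrow> bool" where
  "subset_solution I X \<longleftrightarrow> X \<in> nonempty_subsets I \<and> \<Sum>X = 0"

text \<open>
  An algorithm is a deterministic machine over arbitrary types of states and of elementary
  operations. One transition is one step; the step that leaves state s performs all the operations
  in the set operations V s (possibly in parallel). The set necessary V I X consists of the
  operations that are necessary to determine the subset X of the input-set I independently of the
  other subsets. The value verdict V s X is None as long as X is undetermined, and Some b once it is
  determined, b telling whether X was found to be a subset-solution.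
\<close>

record ('s, 'op) algorithm =
  start :: "int set \<Rightarrow> 's"
  halted :: "'s \<Rightarrow> bool"
  next_state :: "'s \<Rightarrow> 's"
  operations :: "'s \<Rightarrow> 'op set"
  necessary :: "int set \<Rightarrow> int set \<Rightarrow> 'op set"
  verdict :: "'s \<Rightarrow> int set \<Rightarrow> bool option"

text \<open>
  Steps are numbered from 1, and state_after V I j is the state after the first j steps on I. A
  halted machine stays in its state and performs no operations: these are the empty steps that pad
  every run to the worst-case number of steps.
\<close>

primrec state_after :: "('s, 'op) algorithm \<Rightarrow> int set \<Rightarrow> nat \<Rightarrow> 's" where
  "state_after V I 0 = start V I"
| "state_after V I (Suc j) =
    (if halted V (state_after V I j) then state_after V I j
     else next_state V (state_after V I j))"

primrec performed :: "('s, 'op) algorithm \<Rightarrow> int set \<Rightarrow> nat \<Rightarrow> 'op set" where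
  "performed V I 0 = {}"
| "performed V I (Suc j) = performed V I j \<union>
    (if halted V (state_after V I j) then {} else operations V (state_after V I j))"

definition checked :: "('s, 'op) algorithm \<Rightarrow> int set \<Rightarrow> nat \<Rightarrow> int set set" where
  "checked V I j = {X \<in> nonempty_subsets I. 1 \<le> j \<and>
     necessary V I X \<subseteq> performed V I j \<and> \<not> necessary V I X \<subseteq> performed V I (j - 1)}"

definition main_step :: "('s, 'op) algorithm \<Rightarrow> int set \<Rightarrow> nat \<Rightarrow> bool" where
  "main_step V I j \<longleftrightarrow> checked V I j \<noteq> {}"

text \<open>
  The algorithm has a worst-case number of steps for every input size, it determines every non-empty
  subset of every input-set, and it does so correctly; a subset is determined exactly when the
  operations necessary for it have been performed.
\<close>

definition subset_sum_algorithm :: "('s, 'op) algorithm \<Rightarrow> bool" where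
  "subset_sum_algorithm V \<longleftrightarrow>
     (\<forall>n. \<exists>k. \<forall>I\<in>input_sets n. halted V (state_after V I k)) \<and>
     (\<forall>I X. finite I \<longrightarrow> X \<in> nonempty_subsets I \<longrightarrow>
        necessary V I X \<noteq> {} \<and>
        (\<forall>j. verdict V (state_after V I j) X \<noteq> None \<longleftrightarrow> necessary V I X \<subseteq> performed V I j) \<and>
        (\<forall>j. halted V (state_after V I j) \<longrightarrow> verdict V (state_after V I j) X \<noteq> None) \<and>
        (\<forall>j b. verdict V (state_after V I j) X = Some b \<longrightarrow> (b \<longleftrightarrow> subset_solution I X)))"

definition P2_algorithm :: "('s, 'op) algorithm \<Rightarrow> bool" where
  "P2_algorithm V \<longleftrightarrow> subset_sum_algorithm V \<and>
     (\<exists>I j. finite I \<and> main_step V I j \<and> card (checked V I j) > 1)"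

definition number_of_steps :: "('s, 'op) algorithm \<Rightarrow> nat \<Rightarrow> nat" where
  "number_of_steps V n = (LEAST k. \<forall>I\<in>input_sets n. halted V (state_after V I k))"

definition distribution :: "('s, 'op) algorithm \<Rightarrow> int set \<Rightarrow> nat list" where
  "distribution V I = map (\<lambda>j. card (checked V I j)) [1..<Suc (number_of_steps V (card I))]"

definition input_class :: "('s, 'op) algorithm \<Rightarrow> nat \<Rightarrow> nat list \<Rightarrow> int set set \<Rightarrow> bool" where
  "input_class V n d C \<longleftrightarrow> infinite C \<and> C \<subseteq> {I \<in> input_sets n. distribution V I = d}"

definition found_in_step :: "('s, 'op) algorithm \<Rightarrow> int set \<Rightarrow> nat \<Rightarrow> int set set" where
  "found_in_step V I i = {X \<in> checked V I i. verdict V (state_after V I i) X = Some True}"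

text \<open>
  A labelling place assigns to an input-set I and a subset X checked in step i on I the place of X
  in that step.
\<close>

definition found_in_place ::
  "('s, 'op) algorithm \<Rightarrow> (int set \<Rightarrow> int set \<Rightarrow> nat) \<Rightarrow> nat \<Rightarrow> int set \<Rightarrow> nat \<Rightarrow> bool" where
  "found_in_place V place i I p \<longleftrightarrow> (\<exists>X \<in> found_in_step V I i. place I X = p)"

text \<open>No outcome is assigned if subset-solutions are found in both places.\<close>

definition outcome ::
  "('s, 'op) algorithm \<Rightarrow> (int set \<Rightarrow> int set \<Rightarrow> nat) \<Rightarrow> nat \<Rightarrow> int set \<Rightarrow> nat option" where
  "outcome V place i I =
     (if found_in_place V place i I 1 \<and> \<not> found_in_place V place i I 2 then Some 1
      else if found_in_place V place i I 2 \<and> \<not> found_in_place V place i I 1 then Some 2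
      else if found_in_step V I i = {} then Some 0
      else None)"

text \<open>Only meant for the case where b is nonzero and a1 + a2 is at most b.\<close>

definition selection_box :: "'a \<Rightarrow> 'a \<Rightarrow> 'a \<Rightarrow> nat \<Rightarrow> nat \<Rightarrow> nat \<Rightarrow> 'a multiset" where
  "selection_box S R T a1 a2 b =
     replicate_mset a1 S + replicate_mset a2 R + replicate_mset (b - (a1 + a2)) T"

end

(* The limit at 1 is 1 along 1 - 1/(m+1), because each of these points is served by a box of S and T
   only, whereas the box for 1 contains no copy of S. *)
theory Submission
  imports Defs
begin

text \<open>Among the three input-sets only \<open>S\<close> has outcome 1, so
  \<open>\<pi>1 q\<close> is the share of copies of \<open>S\<close> in the box for \<open>q\<close>
  (\<open>prob_selection_box\<close>). That share is a/b = q for every rational q < 1, but the box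
  for 1 realises its value with copies of \<open>R\<close>, giving share 0. So \<open>\<pi>1\<close>
  is the identity up to a jump at 1, and density of the rationals makes the jump visible inside the
  domain (\<open>not_continuous_at_1_within_Rats\<close>).\<close>

lemma prob_selection_box:
  assumes "b \<noteq> 0" "a1 + a2 \<le> b" "S \<in> A" "R \<notin> A" "T \<notin> A"
  shows "measure_pmf.prob (pmf_of_multiset (selection_box S R T a1 a2 b)) A = real a1 / real b"
proof -
  let ?M = "selection_box S R T a1 a2 b"
  have size: "size ?M = b"
    using assms(2) by (simp add: selection_box_def)
  with assms(1) have ne: "?M \<noteq> {#}"
    by auto
  \<comment> \<open>With \<open>a1 = 0\<close> the set \<open>A\<close> misses the support;
    otherwise the event is the single point \<open>S\<close>.\<close>
  have "set_mset ?M \<inter> A = (if a1 = 0 then {} else {S})"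
    using assms(3-5) by (auto simp: selection_box_def in_replicate_mset)
  \<comment> \<open>Membership in \<open>A\<close> separates \<open>S\<close> from \<open>R\<close>
    and \<open>T\<close>, so their copies add nothing to the count of \<open>S\<close>;
    \<open>R\<close> and \<open>T\<close> may coincide.\<close>
  moreover have "R \<noteq> S" "T \<noteq> S"
    using assms(3-5) by auto
  then have "count ?M S = a1"
    by (simp add: selection_box_def)
  moreover have "measure_pmf.prob (pmf_of_multiset ?M) A =
      measure_pmf.prob (pmf_of_multiset ?M) (set_mset ?M \<inter> A)"
    using measure_Int_set_pmf[of "pmf_of_multiset ?M" A] ne by (simp add: Int_commute)
  ultimately show ?thesis
    using ne size by (simp add: measure_pmf_single)
qed

lemma not_continuous_at_1_within_Rats:
  fixes f :: "real \<Rightarrow> real"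
  assumes "\<And>q. q \<in> \<rat> \<inter> {0..<1} \<Longrightarrow> f q = q" "f 1 \<noteq> 1"
  shows "\<not> continuous (at 1 within \<rat> \<inter> {0..1}) f"
proof
  assume "continuous (at 1 within \<rat> \<inter> {0..1}) f"
  \<comment> \<open>A rational sequence in [0,1) tending to 1; the shift by one gives
    \<open>x 0 = 0\<close> and avoids division by zero.\<close>
  moreover define x where "x m = 1 - 1 / (real m + 1)" for m
  have x_in: "x m \<in> \<rat> \<inter> {0..<1}" for m
    by (auto simp: x_def field_simps)
  then have "x m \<in> \<rat> \<inter> {0..1}" for m
    by (meson Int_iff atLeastAtMost_iff atLeastLessThan_iff less_imp_le)
  moreover have lim: "x \<longlonglongrightarrow> 1"
    using tendsto_diff[OF tendsto_const LIMSEQ_inverse_real_of_nat, of "1::real"]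
    by (simp add: x_def[abs_def] inverse_eq_divide add.commute)
  ultimately have "(\<lambda>m. f (x m)) \<longlonglongrightarrow> f 1"
    unfolding continuous_within_sequentially by (simp add: o_def)
  \<comment> \<open>Since \<open>f\<close> fixes every \<open>x m\<close>, continuity would make
    \<open>f 1\<close> a second limit of \<open>x\<close>.\<close>
  with assms(1)[OF x_in] have "x \<longlonglongrightarrow> f 1"
    by simp
  with lim assms(2) show False
    using LIMSEQ_unique by blast
qed

theorem mainTheorem2:
  fixes V :: "('s, 'op) algorithm"
    and n i :: nat
    and d :: "nat list"
    and C :: "int set set"
    and place :: "int set \<Rightarrow> int set \<Rightarrow> nat"
    and S R T :: "int set"
    and F :: "real \<Rightarrow> int set multiset"
    and \<pi>1 :: "real \<Rightarrow> real"
  assumes "P2_algorithm V"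
    and "input_class V n d C"
    and "1 \<le> i" "i \<le> length d" "d ! (i - 1) = 2"
    and "\<And>I. I \<in> C \<Longrightarrow> main_step V I i \<and> bij_betw (place I) (checked V I i) {1, 2}"
    and "S \<in> C" "R \<in> C" "T \<in> C"
    and "found_in_place V place i S 1" "\<not> found_in_place V place i S 2"
    and "found_in_place V place i R 2" "\<not> found_in_place V place i R 1"
    and "found_in_step V T i = {}"
    and "\<And>q. q \<in> \<rat> \<inter> {0..<1} \<Longrightarrow>
           \<exists>a b. b \<noteq> 0 \<and> a \<le> b \<and> real a / real b = q \<and> F q = selection_box S R T a 0 b"
    and "\<exists>b. b \<noteq> 0 \<and> F 1 = selection_box S R T 0 b b"
    and "\<And>q. q \<in> \<rat> \<inter> {0..1} \<Longrightarrow>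
           \<pi>1 q = measure_pmf.prob (pmf_of_multiset (F q)) {I. outcome V place i I = Some 1}"
  shows "(\<forall>q \<in> \<rat> \<inter> {0..1}. \<pi>1 q = (if q < 1 then q else 0)) \<and>
         \<pi>1 ` (\<rat> \<inter> {0..1}) \<subseteq> {0..1} \<and>
         \<not> continuous (at 1 within \<rat> \<inter> {0..1}) \<pi>1"
proof -
  let ?A = "{I. outcome V place i I = Some 1}"
  \<comment> \<open>The outcomes are \<open>Some 1\<close>, \<open>Some 2\<close> and
    \<open>Some 0\<close>; for \<open>T\<close>, nothing found in the step means nothing found in
    either place.\<close>
  have mem: "S \<in> ?A" "R \<notin> ?A" "T \<notin> ?A"
    using assms(10-14) by (auto simp: outcome_def found_in_place_def)
  have below: "\<pi>1 q = q" if q: "q \<in> \<rat> \<inter> {0..<1}" for q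
  proof -
    obtain a b where "b \<noteq> 0" "a \<le> b" "real a / real b = q" "F q = selection_box S R T a 0 b"
      using assms(15)[OF q] by blast
    moreover have "\<pi>1 q = measure_pmf.prob (pmf_of_multiset (F q)) ?A"
      using assms(17) q by auto
    ultimately show ?thesis
      using prob_selection_box[OF _ _ mem, of b a 0] by simp
  qed
  have at_1: "\<pi>1 1 = 0"
  proof -
    obtain b where "b \<noteq> 0" "F 1 = selection_box S R T 0 b b"
      using assms(16) by blast
    \<comment> \<open>This box holds only copies of \<open>R\<close>, so the share of
      \<open>S\<close> is 0/b.\<close>
    then show ?thesis
      using assms(17)[of 1] prob_selection_box[OF _ _ mem, of b 0 b] by simp
  qed
  have pi1_eq: "\<forall>q \<in> \<rat> \<inter> {0..1}. \<pi>1 q = (if q < 1 then q else 0)"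
    using below at_1 by (auto simp: order.order_iff_strict)
  then have "\<pi>1 ` (\<rat> \<inter> {0..1}) \<subseteq> {0..1}"
    by auto
  with pi1_eq show ?thesis
    using not_continuous_at_1_within_Rats[of \<pi>1] below at_1 by simp
qed

end
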